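(* Let $L$ be a subspace of $\mathbb{C}^n$ and suppose that $L$ is the (vector space) direct sum of subspaces $L_1,\dots,L_p$. For each $i$ let $F_i$ be the face of the state space $K_n$ of $\mathcal{B}(\mathbb{C}^n)$ associated with $L_i$. Then the convex hull of $F_1,\dots,F_p$ is the direct convex sum of $F_1,\dots,F_p$. In particular, if $x_1,\dots,x_p$ are linearly independent unit vectors in $\mathbb{C}^n$, then the vector states $\omega_{x_1},\dots,\omega_{x_p}$ are linearly independent (over $\mathbb{R}$) and their convex hull is a simplex.
   Context: For a unit vector $x\in\mathbb{C}^n$, $\omega_x$ denotes the vector state $\omega_x(A)=(Ax,x)$ on $\mathcal{B}(\mathbb{C}^n)$; $K_n$ denotes the convex set of states on $\mathcal{B}(\mathbb{C}^n)$. The face of $K_n$ associated with a subspace $M\subseteq\mathbb{C}^n$ (with orthogonal projection $Q$ onto $M$) is $F_Q=\{\omega\in K_n:\omega(Q)=1\}$; it is the convex hull of the vector states $\omega_x$ with $x\in M$ a unit vector. A convex set $C$ is the direct convex sum of convex subsets $C_1,\dots,C_p$ if each $\omega\in C$ can be written uniquely as $\omega=\sum_{i\in I}\lambda_i\omega_i$ with $I\subseteq\{1,\dots,p\}$, $\lambda_i>0$, $\sum_{i\in I}\lambda_i=1$, $\omega_i\in C_i$. A finite-dimensional convex set is a simplex if it is the direct convex sum of finitely many points. *)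

theory Defs
  imports "HOL-Analysis.Analysis"
begin

text \<open>Operators on C^n are represented as complex n x n matrices (type complex^'n^'n),
  functionals on B(C^n) as functions from matrices to complex numbers.\<close>

definition cinner :: "complex^'n \<Rightarrow> complex^'n \<Rightarrow> complex" where
  "cinner x y = (\<Sum>i\<in>UNIV. x$i * cnj (y$i))"

definition madj :: "complex^'n^'n \<Rightarrow> complex^'n^'n" where
  "madj A = (\<chi> i j. cnj (A$j$i))"

definition mscale :: "complex \<Rightarrow> complex^'n^'n \<Rightarrow> complex^'n^'n" where
  "mscale c A = (\<chi> i j. c * A$i$j)"

text \<open>Vector state omega_x(A) = (Ax, x).\<close>
definition vstate :: "complex^'n \<Rightarrow> (complex^'n^'n \<Rightarrow> complex)" where
  "vstate x = (\<lambda>A. cinner (A *v x) x)"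

text \<open>States: positive normalised linear functionals on B(C^n).\<close>
definition is_state :: "(complex^'n^'n \<Rightarrow> complex) \<Rightarrow> bool" where
  "is_state \<omega> \<longleftrightarrow>
     (\<forall>A B. \<omega> (A + B) = \<omega> A + \<omega> B) \<and>
     (\<forall>c A. \<omega> (mscale c A) = c * \<omega> A) \<and>
     (\<forall>A. Im (\<omega> (madj A ** A)) = 0 \<and> Re (\<omega> (madj A ** A)) \<ge> 0) \<and>
     \<omega> (mat 1) = 1"

definition csubspace :: "(complex^'n) set \<Rightarrow> bool" where
  "csubspace S \<longleftrightarrow> 0 \<in> S \<and> (\<forall>x\<in>S. \<forall>y\<in>S. x + y \<in> S) \<and> (\<forall>c. \<forall>x\<in>S. c *s x \<in> S)"

text \<open>Q is the orthogonal projection onto M.\<close>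
definition is_orth_proj :: "complex^'n^'n \<Rightarrow> (complex^'n) set \<Rightarrow> bool" where
  "is_orth_proj Q M \<longleftrightarrow> Q ** Q = Q \<and> madj Q = Q \<and> range (\<lambda>v. Q *v v) = M"

text \<open>The face F_Q of the state space K_n.\<close>
definition face :: "complex^'n^'n \<Rightarrow> (complex^'n^'n \<Rightarrow> complex) set" where
  "face Q = {\<omega>. is_state \<omega> \<and> \<omega> Q = 1}"

text \<open>Convex hull (set of finite convex combinations) of a set of functionals.\<close>
definition fconv_hull :: "('a \<Rightarrow> complex) set \<Rightarrow> ('a \<Rightarrow> complex) set" where
  "fconv_hull S = {f. \<exists>k (c::nat \<Rightarrow> real) g.
      (\<forall>i<k. c i \<ge> 0 \<and> g i \<in> S) \<and> (\<Sum>i<k. c i) = 1 \<and>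
      f = (\<lambda>A. \<Sum>i<k. of_real (c i) * g i A)}"

text \<open>omega = sum_{i in I} lambda_i omega_i with I \<subseteq> {0..<p}, lambda_i > 0, sum = 1, omega_i in C_i.\<close>
definition dcs_rep :: "nat \<Rightarrow> (nat \<Rightarrow> ('a \<Rightarrow> complex) set) \<Rightarrow> ('a \<Rightarrow> complex)
    \<Rightarrow> nat set \<Rightarrow> (nat \<Rightarrow> real) \<Rightarrow> (nat \<Rightarrow> ('a \<Rightarrow> complex)) \<Rightarrow> bool" where
  "dcs_rep p Cs \<omega> I lam w \<longleftrightarrow> I \<subseteq> {..<p} \<and> (\<forall>i\<in>I. lam i > 0 \<and> w i \<in> Cs i) \<and>
      (\<Sum>i\<in>I. lam i) = 1 \<and> \<omega> = (\<lambda>A. \<Sum>i\<in>I. of_real (lam i) * w i A)"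

text \<open>C is the direct convex sum of C_0,...,C_{p-1}.\<close>
definition direct_convex_sum :: "('a \<Rightarrow> complex) set \<Rightarrow> nat \<Rightarrow> (nat \<Rightarrow> ('a \<Rightarrow> complex) set) \<Rightarrow> bool" where
  "direct_convex_sum C p Cs \<longleftrightarrow> (\<forall>\<omega>\<in>C.
      (\<exists>I lam w. dcs_rep p Cs \<omega> I lam w) \<and>
      (\<forall>I lam w J mu v. dcs_rep p Cs \<omega> I lam w \<and> dcs_rep p Cs \<omega> J mu v \<longrightarrow>
          I = J \<and> (\<forall>i\<in>I. lam i = mu i \<and> w i = v i)))"

text \<open>Simplex: direct convex sum of finitely many points (finite-dimensionality is automatic here).\<close>
definition is_simplex :: "('a \<Rightarrow> complex) set \<Rightarrow> bool" where
  "is_simplex C \<longleftrightarrow> (\<exists>m pts. direct_convex_sum C m (\<lambda>i. {pts i}))"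

end

theory Submission
  imports Defs
begin

(* Faces of the state space associated with independent subspaces form a direct convex sum.

   Let Q_1,...,Q_p be the orthogonal projections onto subspaces L_1,...,L_p whose sum is direct.
   Independence yields "separating" matrices E_i (an oblique projection onto L_i along the
   other L_j) with E_i Q_j = delta_ij Q_j.  Every state in the face F_{Q_j} is supported by Q_j,
   i.e. omega(A) = omega(Q_j A Q_j); this follows from positivity.  Hence for a convex
   combination omega = sum_{j in I} lambda_j omega_j with omega_j in F_{Q_j} the i-th term is
   recovered as  omega(E_i^* A E_i) = [i in I] lambda_i omega_i(A),  which gives uniqueness of
   the decomposition; existence is obtained by regrouping a convex combination along the faces,
   each face being convex.  For linearly independent unit vectors x_i the same recovery formula,
   applied to the rank-one projections onto the lines C x_i and to the singletons {omega_{x_i}},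
   gives the linear independence of the vector states and the simplex property. *)

subsection \<open>Adjoints and matrix algebra\<close>

lemma madj_madj [simp]: "madj (madj A) = A"
  by (simp add: madj_def vec_eq_iff)

lemma madj_mult: "madj (A ** B) = madj B ** madj (A::complex^'n^'n)"
  by (simp add: madj_def matrix_matrix_mult_def vec_eq_iff mult.commute)

lemma madj_add: "madj (A + B) = madj A + madj (B::complex^'n^'n)"
  by (simp add: madj_def vec_eq_iff)

lemma madj_diff: "madj (A - B) = madj A - madj (B::complex^'n^'n)"
  by (simp add: madj_def vec_eq_iff)

lemma madj_mat1: "madj (mat 1 :: complex^'n^'n) = mat 1"
  by (simp add: madj_def vec_eq_iff mat_def)

lemma madj_zero: "madj (0 :: complex^'n^'n) = 0"
  by (simp add: madj_def vec_eq_iff)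

lemma madj_mscale: "madj (mscale c A) = mscale (cnj c) (madj (A::complex^'n^'n))"
  by (simp add: madj_def mscale_def vec_eq_iff)

lemma mscale_mult_left: "mscale c A ** B = mscale c (A ** (B::complex^'n^'n))"
  by (simp add: mscale_def matrix_matrix_mult_def vec_eq_iff sum_distrib_left mult.assoc)

lemma mscale_mult_right: "A ** mscale c B = mscale c (A ** (B::complex^'n^'n))"
  by (simp add: mscale_def matrix_matrix_mult_def vec_eq_iff sum_distrib_left mult_ac)

lemma matrix_add_rdistrib: "(A + B) ** C = A ** C + B ** (C::complex^'n^'n)"
  by (simp add: matrix_matrix_mult_def vec_eq_iff distrib_right sum.distrib)

lemma matrix_diff_rdistrib: "(A - B) ** C = A ** C - B ** (C::complex^'n^'n)"
  by (simp add: matrix_matrix_mult_def vec_eq_iff left_diff_distrib sum_subtractf)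

lemma matrix_diff_ldistrib: "C ** (A - B) = C ** A - C ** (B::complex^'n^'n)"
  by (simp add: matrix_matrix_mult_def vec_eq_iff right_diff_distrib sum_subtractf)

subsection \<open>States and their support\<close>

lemma state_add: "is_state \<omega> \<Longrightarrow> \<omega> (A + B) = \<omega> A + \<omega> B"
  unfolding is_state_def by blast

lemma state_zero: "is_state \<omega> \<Longrightarrow> \<omega> 0 = 0"
  using state_add[of \<omega> 0 0] by simp

lemma state_scale: "is_state \<omega> \<Longrightarrow> \<omega> (mscale c A) = c * \<omega> A"
  unfolding is_state_def by blast

lemma state_diff: "is_state \<omega> \<Longrightarrow> \<omega> (A - B) = \<omega> A - \<omega> B"
  using state_add[of \<omega> "A - B" B] by simp

lemma state_pos: "is_state \<omega> \<Longrightarrow> Im (\<omega> (madj A ** A)) = 0 \<and> Re (\<omega> (madj A ** A)) \<ge> 0"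
  unfolding is_state_def by blast

text \<open>A functional is supported by Q if it only sees the compression of its argument to Q.\<close>
definition supported_by :: "complex^'n^'n \<Rightarrow> (complex^'n^'n \<Rightarrow> complex) \<Rightarrow> bool" where
  "supported_by Q \<phi> \<longleftrightarrow> (\<forall>A. \<phi> A = \<phi> (Q ** A ** Q))"

(* If r s + r^2 c is a nonnegative real for every real r (with c \<ge> 0), then s = 0:
   otherwise the quadratic becomes negative near its vertex. *)
lemma nonneg_quadratic_linear_term_zero:
  fixes s c :: complex
  assumes h: "\<And>r::real. Im (of_real r * s + of_real (r^2) * c) = 0 \<and> Re (of_real r * s + of_real (r^2) * c) \<ge> 0"
    and c: "Im c = 0" "Re c \<ge> 0"
  shows "s = 0"
proof -
  have "Im s = 0" using h[of 1] c by simp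
  moreover have "Re s = 0"
  proof (rule ccontr)
    assume ne: "Re s \<noteq> 0"
    define D where "D = Re c + 1"
    have D: "D > 0" using c by (simp add: D_def)
    define r where "r = - Re s / D"
    have "0 \<le> Re (of_real r * s + of_real (r^2) * c)" using h by blast
    also have "\<dots> = r * Re s + r^2 * Re c" using c by simp
    also have "\<dots> = -((Re s)^2 / D^2)"
    proof -
      have "r * Re s + r^2 * Re c = (-((Re s)^2 * D) + (Re s)^2 * Re c) / D^2"
        using D by (simp add: r_def power2_eq_square divide_simps)
      also have "-((Re s)^2 * D) + (Re s)^2 * Re c = -((Re s)^2)" by (simp add: D_def algebra_simps)
      finally show ?thesis by simp
    qed
    also have "\<dots> < 0" using ne D by simp
    finally show False by simp
  qed
  ultimately show ?thesis by (simp add: complex_eq_iff)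
qed

(* A state vanishing on an orthogonal projection P vanishes on P Y and on Y^* P for every Y:
   expand omega((P + tY)^*(P + tY)) \<ge> 0 for t real and t imaginary. *)
lemma state_annihilates_null_projection:
  assumes st: "is_state \<omega>" and P: "madj P = P" "P ** P = P" "\<omega> P = 0"
  shows "\<omega> (P ** Y) = 0 \<and> \<omega> (madj Y ** P) = 0"
proof -
  define a where "a = \<omega> (P ** Y)"
  define b where "b = \<omega> (madj Y ** P)"
  define c where "c = \<omega> (madj Y ** Y)"
  have expand: "\<omega> (madj (P + mscale t Y) ** (P + mscale t Y)) = t * a + cnj t * b + (cnj t * t) * c" for t
  proof -
    have "madj (P + mscale t Y) ** (P + mscale t Y) =
          P ** P + mscale t (P ** Y) + (mscale (cnj t) (madj Y ** P) + mscale (cnj t * t) (madj Y ** Y))"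
      by (simp add: madj_add madj_mscale P(1) matrix_add_ldistrib matrix_add_rdistrib
            mscale_mult_left mscale_mult_right)
         (simp add: mscale_def vec_eq_iff algebra_simps)
    then show ?thesis
      using st P by (simp add: state_add state_scale a_def b_def c_def)
  qed
  have c: "Im c = 0" "Re c \<ge> 0" using state_pos[OF st, of Y] c_def by auto
  have sum_zero: "a + b = 0"
  proof (rule nonneg_quadratic_linear_term_zero[OF _ c])
    fix r :: real
    have "of_real r * (a + b) + of_real (r^2) * c = \<omega> (madj (P + mscale (of_real r) Y) ** (P + mscale (of_real r) Y))"
      by (simp add: expand algebra_simps power2_eq_square)
    then show "Im (of_real r * (a + b) + of_real (r^2) * c) = 0 \<and> Re (of_real r * (a + b) + of_real (r^2) * c) \<ge> 0"
      using state_pos[OF st] by simp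
  qed
  have diff_zero: "\<i> * (a - b) = 0"
  proof (rule nonneg_quadratic_linear_term_zero[OF _ c])
    fix r :: real
    have "of_real r * (\<i> * (a - b)) + of_real (r^2) * c = \<omega> (madj (P + mscale (\<i> * of_real r) Y) ** (P + mscale (\<i> * of_real r) Y))"
      by (simp add: expand algebra_simps power2_eq_square)
    then show "Im (of_real r * (\<i> * (a - b)) + of_real (r^2) * c) = 0 \<and> Re (of_real r * (\<i> * (a - b)) + of_real (r^2) * c) \<ge> 0"
      using state_pos[OF st] by simp
  qed
  from sum_zero diff_zero have "a = 0" "b = 0" by auto
  then show ?thesis by (simp add: a_def b_def)
qed

(* Every state of the face F_Q is supported by Q: it vanishes on (1 - Q) A and on A (1 - Q). *)
lemma face_supported:
  fixes Q :: "complex^'n^'n"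
  assumes w: "\<omega> \<in> face Q" and Q: "is_orth_proj Q M"
  shows "supported_by Q \<omega>"
  unfolding supported_by_def
proof
  fix A :: "complex^'n^'n"
  have st: "is_state \<omega>" and wQ: "\<omega> Q = 1" using w by (auto simp: face_def)
  have QQ: "Q ** Q = Q" "madj Q = Q" using Q by (auto simp: is_orth_proj_def)
  define P where "P = mat 1 - Q"
  have P_adj: "madj P = P" by (simp add: P_def madj_diff madj_mat1 QQ)
  have P_idem: "P ** P = P" by (simp add: P_def matrix_diff_ldistrib matrix_diff_rdistrib QQ)
  have P_null: "\<omega> P = 0" using st wQ by (simp add: P_def state_diff is_state_def)
  note kill = state_annihilates_null_projection[OF st P_adj P_idem P_null]
  have "A = Q ** A + P ** A" by (simp add: P_def matrix_diff_rdistrib)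
  then have "\<omega> A = \<omega> (Q ** A)" using kill st by (metis state_add add.right_neutral)
  also have "Q ** A = Q ** A ** Q + Q ** A ** P" by (simp add: P_def matrix_diff_ldistrib)
  then have "\<omega> (Q ** A) = \<omega> (Q ** A ** Q)" using kill[of "madj (Q ** A)"] st
    by (metis madj_madj state_add add.right_neutral)
  finally show "\<omega> A = \<omega> (Q ** A ** Q)" .
qed

(* Unpacking membership in the convex hull into an explicit convex combination. *)
lemma fconv_hull_memberE:
  assumes "\<omega> \<in> fconv_hull C"
  obtains K :: nat and c g where "\<forall>k<K. 0 \<le> c k \<and> g k \<in> C" "(\<Sum>k<K. c k) = 1"
      and "\<omega> = (\<lambda>A. \<Sum>k<K. of_real (c k) * g k A)"
  using assms unfolding fconv_hull_def by blast

(* Faces are closed under finite convex combinations. *)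
lemma face_convex: "fconv_hull (face Q) \<subseteq> face Q"
proof
  fix \<omega> assume "\<omega> \<in> fconv_hull (face Q)"
  then obtain K :: nat and c g where cg: "\<forall>k<K. 0 \<le> c k \<and> g k \<in> face Q" "(\<Sum>k<K. c k) = 1"
      and \<omega>: "\<omega> = (\<lambda>A. \<Sum>k<K. of_real (c k) * g k A)"
    by (rule fconv_hull_memberE)
  have st: "is_state (g k)" and gQ: "g k Q = 1" if "k < K" for k
    using cg(1) that by (auto simp: face_def)
  have total: "(\<Sum>k<K. of_real (c k) :: complex) = 1"
    using cg(2) by (metis of_real_1 of_real_sum)
  have "is_state \<omega>"
    unfolding is_state_def \<omega>
  proof (intro conjI allI)
    fix A B
    show "(\<Sum>k<K. of_real (c k) * g k (A + B)) = (\<Sum>k<K. of_real (c k) * g k A) + (\<Sum>k<K. of_real (c k) * g k B)"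
      by (simp add: state_add[OF st] distrib_left sum.distrib)
  next
    fix d A
    show "(\<Sum>k<K. of_real (c k) * g k (mscale d A)) = d * (\<Sum>k<K. of_real (c k) * g k A)"
      by (simp add: state_scale[OF st] sum_distrib_left mult_ac)
  next
    fix A
    have im: "Im (g k (madj A ** A)) = 0" and re: "Re (g k (madj A ** A)) \<ge> 0" if "k < K" for k
      using state_pos[OF st[OF that]] by auto
    show "Im (\<Sum>k<K. of_real (c k) * g k (madj A ** A)) = 0"
      by (simp add: Im_sum im)
    show "Re (\<Sum>k<K. of_real (c k) * g k (madj A ** A)) \<ge> 0"
      unfolding Re_sum using cg(1) re by (auto intro!: sum_nonneg mult_nonneg_nonneg)
  next
    show "(\<Sum>k<K. of_real (c k) * g k (mat 1)) = 1"
      using st total by (simp add: is_state_def)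
  qed
  moreover have "\<omega> Q = 1" using gQ total by (simp add: \<omega>)
  ultimately show "\<omega> \<in> face Q" by (simp add: face_def)
qed

subsection \<open>Separating matrices for independent subspaces\<close>

text \<open>The matrices E_i separate the projections Q_j: E_i acts as the identity on the range of Q_i
  and kills the ranges of the other Q_j.\<close>
definition separates :: "nat \<Rightarrow> (nat \<Rightarrow> complex^'n^'n) \<Rightarrow> (nat \<Rightarrow> complex^'n^'n) \<Rightarrow> bool" where
  "separates p Qs Es \<longleftrightarrow> (\<forall>i<p. \<forall>j<p. Es i ** Qs j = (if i = j then Qs j else 0))"

(* In a direct sum the decomposition of a vector into components is unique. *)
lemma independent_decomposition_unique:
  fixes Ls :: "nat \<Rightarrow> (complex^'n) set"
  assumes subs: "\<forall>j<p. csubspace (Ls j)"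
    and ind: "\<forall>v. (\<forall>j<p. v j \<in> Ls j) \<and> (\<Sum>j<p. v j) = 0 \<longrightarrow> (\<forall>j<p. v j = 0)"
    and v: "\<forall>j<p. v j \<in> Ls j" and w: "\<forall>j<p. w j \<in> Ls j"
    and same_sum: "(\<Sum>j<p. v j) = (\<Sum>j<p. w j)"
  shows "\<forall>j<p. v j = w j"
proof -
  have "\<forall>j<p. v j + (-1) *s w j \<in> Ls j"
    using v w subs unfolding csubspace_def by blast
  moreover have "(\<Sum>j<p. v j + (-1) *s w j) = 0"
    using same_sum by (simp add: sum_subtractf vector_smult_lneg)
  ultimately have "\<forall>j<p. v j + (-1) *s w j = 0"
    using ind[rule_format, of "\<lambda>j. v j + (-1) *s w j"] by blast
  then show ?thesis by (simp add: vector_smult_lneg)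
qed

(* Taking the i-th component of the decomposition in L = L_1 + ... + L_p is a linear map on L;
   extend it linearly from a basis of L to the whole space. *)
lemma component_map_exists:
  fixes Ls :: "nat \<Rightarrow> (complex^'n) set"
  assumes subs: "\<forall>j<p. csubspace (Ls j)"
    and ind: "\<forall>v. (\<forall>j<p. v j \<in> Ls j) \<and> (\<Sum>j<p. v j) = 0 \<longrightarrow> (\<forall>j<p. v j = 0)"
    and ip: "i < p"
  shows "\<exists>g. Vector_Spaces.linear (*s) (*s) g \<and>
           (\<forall>v. (\<forall>j<p. v j \<in> Ls j) \<longrightarrow> g (\<Sum>j<p. v j) = v i)"
proof -
  define L where "L = {(\<Sum>j<p. v j) | v. \<forall>j<p. v j \<in> Ls j}"
  obtain B where B: "B \<subseteq> L" "vec.independent B" "L \<subseteq> vec.span B"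
    using vec.maximal_independent_subset by blast
  have "\<forall>b\<in>B. \<exists>v. (\<forall>j<p. v j \<in> Ls j) \<and> (\<Sum>j<p. v j) = b"
    using B(1) unfolding L_def by blast
  then obtain dec where dec: "\<And>b. b \<in> B \<Longrightarrow> (\<forall>j<p. dec b j \<in> Ls j) \<and> (\<Sum>j<p. dec b j) = b"
    by metis
  obtain g where g: "Vector_Spaces.linear (*s) (*s) g" "\<forall>b\<in>B. g b = dec b i"
    using vec.linear_independent_extend[OF B(2), of "\<lambda>b. dec b i"] by blast
  interpret g: Vector_Spaces.linear "(*s)" "(*s)" g by (rule g(1))
  (* on span B, g picks the i-th component of some decomposition *)
  have g_component: "\<exists>v. (\<forall>j<p. v j \<in> Ls j) \<and> (\<Sum>j<p. v j) = y \<and> g y = v i"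
    if "y \<in> vec.span B" for y
    using that
  proof (induction rule: vec.span_induct_alt)
    case base
    show ?case by (rule exI[of _ "\<lambda>_. 0"]) (use subs in \<open>auto simp: csubspace_def\<close>)
  next
    case (step c b y)
    then obtain v where v: "\<forall>j<p. v j \<in> Ls j" "(\<Sum>j<p. v j) = y" "g y = v i" by blast
    show ?case
    proof (rule exI[of _ "\<lambda>j. c *s dec b j + v j"], intro conjI)
      show "\<forall>j<p. c *s dec b j + v j \<in> Ls j"
        using dec[OF step(1)] v(1) subs unfolding csubspace_def by blast
      show "(\<Sum>j<p. c *s dec b j + v j) = c *s b + y"
        using dec[OF step(1)] v(2) by (simp add: sum.distrib vec.scale_sum_right[symmetric])
      show "g (c *s b + y) = c *s dec b i + v i"
        using g(2) step(1) v(3) by (simp add: g.add g.scale)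
    qed
  qed
  (* by uniqueness of decompositions, that component is the i-th component of every one *)
  have "g (\<Sum>j<p. v j) = v i" if v: "\<forall>j<p. v j \<in> Ls j" for v
  proof -
    have "(\<Sum>j<p. v j) \<in> vec.span B" using B(3) v unfolding L_def by blast
    then obtain v' where v': "\<forall>j<p. v' j \<in> Ls j" "(\<Sum>j<p. v' j) = (\<Sum>j<p. v j)" "g (\<Sum>j<p. v j) = v' i"
      using g_component by blast
    show ?thesis using independent_decomposition_unique[OF subs ind v'(1) v v'(2)] v'(3) ip by simp
  qed
  with g(1) show ?thesis by blast
qed

(* The projection of L_1 + ... + L_p onto L_i along the other summands, as a matrix. *)
lemma oblique_projection_exists:
  fixes Ls :: "nat \<Rightarrow> (complex^'n) set"
  assumes subs: "\<forall>j<p. csubspace (Ls j)"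
    and ind: "\<forall>v. (\<forall>j<p. v j \<in> Ls j) \<and> (\<Sum>j<p. v j) = 0 \<longrightarrow> (\<forall>j<p. v j = 0)"
    and ip: "i < p"
  shows "\<exists>E::complex^'n^'n. \<forall>j<p. \<forall>y\<in>Ls j. E *v y = (if j = i then y else 0)"
proof -
  obtain g where g: "Vector_Spaces.linear (*s) (*s) g"
      "\<forall>v. (\<forall>j<p. v j \<in> Ls j) \<longrightarrow> g (\<Sum>j<p. v j) = v i"
    using component_map_exists[OF subs ind ip] by blast
  have "matrix g *v y = (if j = i then y else 0)" if jp: "j < p" and y: "y \<in> Ls j" for j y
  proof -
    define d where "d = (\<lambda>k. if k = j then y else (0::complex^'n))"
    have "\<forall>k<p. d k \<in> Ls k" using subs y unfolding d_def csubspace_def by auto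
    moreover have "(\<Sum>k<p. d k) = y" using jp unfolding d_def by (simp add: sum.delta)
    ultimately have "g y = d i" using g(2) by metis
    then show ?thesis by (simp add: matrix_works[OF g(1)] d_def)
  qed
  then show ?thesis by blast
qed

(* Oblique projections separate any family Q_j whose ranges lie in the L_j. *)
lemma separating_matrices_exist:
  fixes Ls :: "nat \<Rightarrow> (complex^'n) set" and Qs :: "nat \<Rightarrow> complex^'n^'n"
  assumes subs: "\<forall>j<p. csubspace (Ls j)"
    and ind: "\<forall>v. (\<forall>j<p. v j \<in> Ls j) \<and> (\<Sum>j<p. v j) = 0 \<longrightarrow> (\<forall>j<p. v j = 0)"
    and ranges: "\<forall>j<p. \<forall>v. Qs j *v v \<in> Ls j"
  shows "\<exists>Es. separates p Qs Es"
proof -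
  obtain Es where Es: "\<And>i. i < p \<Longrightarrow> \<forall>j<p. \<forall>y\<in>Ls j. Es i *v y = (if j = i then y else 0)"
    using oblique_projection_exists[OF subs ind] by metis
  have "Es i ** Qs j = (if i = j then Qs j else 0)" if "i < p" "j < p" for i j
    unfolding matrix_eq
  proof
    fix v
    have "(Es i ** Qs j) *v v = Es i *v (Qs j *v v)" by (simp add: matrix_vector_mul_assoc)
    also have "\<dots> = (if j = i then Qs j *v v else 0)" using Es[OF that(1)] ranges that(2) by blast
    finally show "(Es i ** Qs j) *v v = (if i = j then Qs j else 0) *v v" by auto
  qed
  then show ?thesis unfolding separates_def by blast
qed

subsection \<open>A criterion for direct convex sums\<close>

(* Key formula: compressing by the separating matrix E_i isolates the i-th summand of a sum of
   functionals supported by the Q_j. *)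
lemma component_recovery:
  assumes sa: "\<forall>j<p. madj (Qs j) = Qs j" and sep: "separates p Qs Es"
    and I: "I \<subseteq> {..<p}" and \<phi>: "\<forall>j\<in>I. supported_by (Qs j) (\<phi> j) \<and> \<phi> j 0 = 0"
    and ip: "i < p"
  shows "(\<Sum>j\<in>I. \<phi> j (madj (Es i) ** A ** Es i)) = (if i \<in> I then \<phi> i A else 0)"
proof -
  have summand: "\<phi> j (madj (Es i) ** A ** Es i) = (if j = i then \<phi> i A else 0)" if jI: "j \<in> I" for j
  proof -
    have jp: "j < p" using I jI by blast
    have supp: "\<phi> j B = \<phi> j (Qs j ** B ** Qs j)" for B
      using \<phi> jI unfolding supported_by_def by blast
    have "Qs j ** (madj (Es i) ** A ** Es i) ** Qs j = madj (Es i ** Qs j) ** A ** (Es i ** Qs j)"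
      using sa jp by (simp add: madj_mult matrix_mul_assoc)
    also have "\<dots> = (if j = i then Qs i ** A ** Qs i else 0)"
      using sep ip jp sa unfolding separates_def by (auto simp: madj_zero)
    finally have "\<phi> j (madj (Es i) ** A ** Es i) = \<phi> j (if j = i then Qs i ** A ** Qs i else 0)"
      by (simp only: supp[of "madj (Es i) ** A ** Es i"])
    moreover have "\<phi> j 0 = 0" using \<phi> jI by blast
    ultimately show ?thesis using supp[of A] by (cases "j = i") simp_all
  qed
  moreover have "finite I" using I finite_subset by blast
  ultimately show ?thesis by (simp add: sum.delta)
qed

text \<open>The pieces C_j are normalised with respect to the Q_j: their members are supported by Q_j,
  vanish at 0 and take the value 1 at Q_j.\<close>
definition pieces_normalised :: "nat \<Rightarrow> (nat \<Rightarrow> complex^'n^'n) \<Rightarrow> (nat \<Rightarrow> (complex^'n^'n \<Rightarrow> complex) set) \<Rightarrow> bool" where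
  "pieces_normalised p Qs Cs \<longleftrightarrow>
     (\<forall>j<p. \<forall>\<psi>\<in>Cs j. supported_by (Qs j) \<psi> \<and> \<psi> 0 = 0 \<and> \<psi> (Qs j) = 1)"

(* The recovery formula for a decomposition omega = sum_{j in I} lambda_j omega_j. *)
lemma dcs_rep_recovery:
  assumes sa: "\<forall>j<p. madj (Qs j) = Qs j" and sep: "separates p Qs Es"
    and C: "pieces_normalised p Qs Cs" and r: "dcs_rep p Cs \<omega> I lam w" and ip: "i < p"
  shows "\<omega> (madj (Es i) ** A ** Es i) = (if i \<in> I then of_real (lam i) * w i A else 0)"
proof -
  have I: "I \<subseteq> {..<p}" "\<forall>j\<in>I. w j \<in> Cs j" "\<omega> = (\<lambda>A. \<Sum>j\<in>I. of_real (lam j) * w j A)"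
    using r unfolding dcs_rep_def by auto
  have "\<forall>j\<in>I. supported_by (Qs j) (\<lambda>A. of_real (lam j) * w j A) \<and> of_real (lam j) * w j 0 = 0"
    using I(1,2) C unfolding pieces_normalised_def supported_by_def by (metis lessThan_iff mult_zero_right subsetD)
  from component_recovery[OF sa sep I(1) this ip] show ?thesis by (simp add: I(3))
qed

(* Uniqueness: evaluating the recovered terms at Q_i determines I and the lambda_i,
   and then the omega_i. *)
lemma dcs_rep_unique:
  assumes sa: "\<forall>j<p. madj (Qs j) = Qs j" and sep: "separates p Qs Es"
    and C: "pieces_normalised p Qs Cs"
    and r1: "dcs_rep p Cs \<omega> I lam w" and r2: "dcs_rep p Cs \<omega> J mu v"
  shows "I = J \<and> (\<forall>i\<in>I. lam i = mu i \<and> w i = v i)"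
proof -
  have I: "I \<subseteq> {..<p}" "\<forall>i\<in>I. lam i > 0 \<and> w i \<in> Cs i" and J: "J \<subseteq> {..<p}" "\<forall>i\<in>J. mu i > 0 \<and> v i \<in> Cs i"
    using r1 r2 unfolding dcs_rep_def by auto
  have same: "(if i \<in> I then of_real (lam i) * w i A else 0) = (if i \<in> J then of_real (mu i) * v i A else 0)"
    if "i < p" for i A
    using dcs_rep_recovery[OF sa sep C r1 that] dcs_rep_recovery[OF sa sep C r2 that] by simp
  have at_Q: "(if i \<in> I then lam i else 0) = (if i \<in> J then mu i else 0)" if ip: "i < p" for i
  proof -
    have "i \<in> I \<Longrightarrow> w i (Qs i) = 1" "i \<in> J \<Longrightarrow> v i (Qs i) = 1"
      using C I(2) J(2) ip unfolding pieces_normalised_def by auto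
    then show ?thesis using same[OF ip, of "Qs i"] by (auto split: if_splits)
  qed
  have IJ: "I = J" using at_Q I J by (force split: if_splits)
  have "lam i = mu i \<and> w i = v i" if iI: "i \<in> I" for i
  proof
    have ip: "i < p" using I(1) iI by blast
    show lm: "lam i = mu i" using at_Q[OF ip] iI IJ by simp
    show "w i = v i"
    proof
      fix A
      have "lam i > 0" using I(2) iI by blast
      then show "w i A = v i A" using same[OF ip, of A] iI IJ lm by simp
    qed
  qed
  with IJ show ?thesis by blast
qed

(* A convex combination of members of C indexed by a finite set of indices lies in C. *)
lemma fconv_hull_subset_sum:
  assumes hull: "fconv_hull C \<subseteq> C" and S: "S \<subseteq> {..<(K::nat)}"
    and d: "\<forall>k\<in>S. 0 \<le> d k \<and> g k \<in> C" and total: "(\<Sum>k\<in>S. d k) = 1"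
  shows "(\<lambda>A. \<Sum>k\<in>S. of_real (d k) * g k A) \<in> C"
proof -
  obtain k0 where k0: "k0 \<in> S" using total by fastforce
  define c where "c k = (if k \<in> S then d k else 0)" for k
  define g' where "g' k = (if k \<in> S then g k else g k0)" for k
  have restrict: "(\<Sum>k<K. f k) = (\<Sum>k\<in>S. f k)" if "\<And>k. k \<notin> S \<Longrightarrow> f k = 0"
    for f :: "nat \<Rightarrow> 'b::comm_monoid_add"
    using S that by (intro sum.mono_neutral_right) auto
  have "(\<lambda>A. \<Sum>k<K. of_real (c k) * g' k A) \<in> fconv_hull C"
    unfolding fconv_hull_def mem_Collect_eq
  proof (intro exI conjI)
    show "\<forall>k<K. 0 \<le> c k \<and> g' k \<in> C" using d k0 by (simp add: c_def g'_def)
    show "(\<Sum>k<K. c k) = 1" using total restrict[of c] by (simp add: c_def)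
  qed (rule refl)
  moreover have "(\<Sum>k<K. of_real (c k) * g' k A) = (\<Sum>k\<in>S. of_real (d k) * g k A)" for A
  proof -
    have "(\<Sum>k<K. of_real (c k) * g' k A) = (\<Sum>k\<in>S. of_real (c k) * g' k A)"
      by (rule restrict) (simp add: c_def)
    then show ?thesis by (simp add: c_def g'_def)
  qed
  ultimately show ?thesis using hull by auto
qed

(* Regrouping a finite sum according to an index map. *)
lemma sum_group_by_index:
  assumes "\<forall>k<K. idx k < (p::nat)"
  shows "(\<Sum>k<(K::nat). f k) = (\<Sum>i<p. \<Sum>k\<in>{k \<in> {..<K}. idx k = i}. f k)"
proof -
  have "idx ` {..<K} \<subseteq> {..<p}" using assms by auto
  from sum.group[OF finite_lessThan finite_lessThan this, of f] show ?thesis by simp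
qed

(* A convex combination whose k-th term lies in the piece C_(idx k) decomposes as a direct
   convex sum: group the terms by piece and normalise each group by its total weight. *)
lemma dcs_rep_of_indexed_combination:
  fixes Cs :: "nat \<Rightarrow> ('a \<Rightarrow> complex) set"
  assumes hull: "\<forall>i<p. fconv_hull (Cs i) \<subseteq> Cs i"
    and c: "\<forall>k<K. 0 \<le> c k \<and> idx k < p \<and> g k \<in> Cs (idx k)" "(\<Sum>k<(K::nat). c k) = 1"
  shows "\<exists>I lam w. dcs_rep p Cs (\<lambda>A. \<Sum>k<K. of_real (c k) * g k A) I lam w"
proof -
  define S where "S i = {k \<in> {..<K}. idx k = i}" for i
  define lam where "lam i = (\<Sum>k\<in>S i. c k)" for i
  define I where "I = {i. i < p \<and> lam i > 0}"
  define w where "w i = (\<lambda>A. \<Sum>k\<in>S i. of_real (c k / lam i) * g k A)" for i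
  have regroup: "(\<Sum>k<K. f k) = (\<Sum>i<p. \<Sum>k\<in>S i. f k)" for f :: "nat \<Rightarrow> 'b::comm_monoid_add"
    unfolding S_def using c(1) by (intro sum_group_by_index) blast
  have S_sub: "S i \<subseteq> {..<K}" for i by (auto simp: S_def)
  have onto_I: "(\<Sum>i<p. f i) = (\<Sum>i\<in>I. f i)" if "\<And>i. i < p \<Longrightarrow> i \<notin> I \<Longrightarrow> f i = 0"
    for f :: "nat \<Rightarrow> 'b::comm_monoid_add"
    using that by (intro sum.mono_neutral_right) (auto simp: I_def)
  have lam_zero: "lam i = 0" if "i < p" "i \<notin> I" for i
  proof -
    have "lam i \<ge> 0" unfolding lam_def using c(1) S_sub by (meson lessThan_iff subsetD sum_nonneg)
    then show ?thesis using that by (auto simp: I_def)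
  qed
  have vanish: "c k = 0" if "i < p" "i \<notin> I" "k \<in> S i" for i k
    using sum_nonneg_eq_0_iff[of "S i" c] lam_zero[OF that(1,2)] c(1) S_sub that(3)
    unfolding lam_def by (auto simp: S_def)
  have w_in: "w i \<in> Cs i" if "i \<in> I" for i
  proof -
    have lp: "lam i > 0" and ip: "i < p" using that by (auto simp: I_def)
    have "(\<Sum>k\<in>S i. c k / lam i) = 1" using lp by (simp add: lam_def sum_divide_distrib[symmetric])
    moreover have "\<forall>k\<in>S i. 0 \<le> c k / lam i \<and> g k \<in> Cs i" using c(1) lp by (auto simp: S_def)
    ultimately show ?thesis
      unfolding w_def using fconv_hull_subset_sum[of "Cs i" "S i" K "\<lambda>k. c k / lam i" g] hull ip S_sub
      by blast
  qed
  have weighted: "of_real (lam i) * w i A = (\<Sum>k\<in>S i. of_real (c k) * g k A)" if "i \<in> I" for i A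
    using that unfolding w_def by (simp add: I_def sum_distrib_left)
  have "dcs_rep p Cs (\<lambda>A. \<Sum>k<K. of_real (c k) * g k A) I lam w"
    unfolding dcs_rep_def
  proof (intro conjI ballI)
    show "I \<subseteq> {..<p}" by (auto simp: I_def)
  next
    fix i assume "i \<in> I"
    then show "lam i > 0" "w i \<in> Cs i" using w_in by (auto simp: I_def)
  next
    have "(\<Sum>i\<in>I. lam i) = (\<Sum>i<p. lam i)" using lam_zero by (intro onto_I[symmetric])
    also have "\<dots> = (\<Sum>k<K. c k)" unfolding lam_def by (rule regroup[symmetric])
    finally show "(\<Sum>i\<in>I. lam i) = 1" using c(2) by simp
  next
    have "(\<Sum>k<K. of_real (c k) * g k A) = (\<Sum>i\<in>I. of_real (lam i) * w i A)" for A
    proof -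
      have "(\<Sum>k<K. of_real (c k) * g k A) = (\<Sum>i<p. \<Sum>k\<in>S i. of_real (c k) * g k A)"
        by (rule regroup)
      also have "\<dots> = (\<Sum>i\<in>I. \<Sum>k\<in>S i. of_real (c k) * g k A)"
        using vanish by (intro onto_I) simp
      finally show ?thesis by (simp add: weighted)
    qed
    then show "(\<lambda>A. \<Sum>k<K. of_real (c k) * g k A) = (\<lambda>A. \<Sum>i\<in>I. of_real (lam i) * w i A)"
      by blast
  qed
  then show ?thesis by blast
qed

(* Existence: choose for each term of a convex combination a piece containing it. *)
lemma dcs_rep_exists:
  fixes Cs :: "nat \<Rightarrow> ('a \<Rightarrow> complex) set"
  assumes hull: "\<forall>i<p. fconv_hull (Cs i) \<subseteq> Cs i" and om: "\<omega> \<in> fconv_hull (\<Union>i<p. Cs i)"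
  shows "\<exists>I lam w. dcs_rep p Cs \<omega> I lam w"
proof -
  obtain K :: nat and c g where c: "\<forall>k<K. 0 \<le> c k \<and> g k \<in> (\<Union>i<p. Cs i)" "(\<Sum>k<K. c k) = 1"
      and \<omega>: "\<omega> = (\<lambda>A. \<Sum>k<K. of_real (c k) * g k A)"
    using om by (rule fconv_hull_memberE)
  have "\<forall>k. \<exists>i. k < K \<longrightarrow> i < p \<and> g k \<in> Cs i" using c(1) by blast
  then have "\<exists>idx. \<forall>k. k < K \<longrightarrow> idx k < p \<and> g k \<in> Cs (idx k)" by (rule choice)
  then obtain idx where "\<forall>k<K. 0 \<le> c k \<and> idx k < p \<and> g k \<in> Cs (idx k)" using c(1) by blast
  from dcs_rep_of_indexed_combination[OF hull this c(2)] show ?thesis by (simp add: \<omega>)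
qed

(* Convex pieces, normalised with respect to separated self-adjoint Q_j, form a direct
   convex sum. *)
theorem direct_convex_sum_criterion:
  assumes sa: "\<forall>j<p. madj (Qs j) = Qs j" and sep: "separates p Qs Es"
    and hull: "\<forall>i<p. fconv_hull (Cs i) \<subseteq> Cs i" and C: "pieces_normalised p Qs Cs"
  shows "direct_convex_sum (fconv_hull (\<Union>i<p. Cs i)) p Cs"
  unfolding direct_convex_sum_def
  using dcs_rep_exists[OF hull] dcs_rep_unique[OF sa sep C] by blast

subsection \<open>Faces of independent subspaces\<close>

(* First part of the theorem: faces of independent subspaces form a direct convex sum. *)
theorem faces_direct_convex_sum:
  fixes Ls :: "nat \<Rightarrow> (complex^'n) set" and Qs :: "nat \<Rightarrow> complex^'n^'n"
  assumes subs: "\<forall>i<p. csubspace (Ls i)"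
    and ind: "\<forall>v. (\<forall>i<p. v i \<in> Ls i) \<and> (\<Sum>i<p. v i) = 0 \<longrightarrow> (\<forall>i<p. v i = 0)"
    and orth: "\<forall>i<p. is_orth_proj (Qs i) (Ls i)"
  shows "direct_convex_sum (fconv_hull (\<Union>i<p. face (Qs i))) p (\<lambda>i. face (Qs i))"
proof -
  have sa: "\<forall>j<p. madj (Qs j) = Qs j" using orth by (auto simp: is_orth_proj_def)
  have "\<forall>j<p. \<forall>v. Qs j *v v \<in> Ls j" using orth by (auto simp: is_orth_proj_def)
  then obtain Es where sep: "separates p Qs Es"
    using separating_matrices_exist[OF subs ind] by blast
  have "pieces_normalised p Qs (\<lambda>i. face (Qs i))"
    unfolding pieces_normalised_def
  proof (intro allI impI ballI conjI)
    fix j \<psi> assume j: "j < p" and \<psi>: "\<psi> \<in> face (Qs j)"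
    show "supported_by (Qs j) \<psi>" using face_supported[OF \<psi>] orth j by blast
    show "\<psi> 0 = 0" "\<psi> (Qs j) = 1" using \<psi> state_zero by (auto simp: face_def)
  qed
  then show ?thesis
    by (intro direct_convex_sum_criterion[OF sa sep]) (simp add: face_convex)
qed

subsection \<open>Vector states\<close>

lemma cinner_scale: "cinner (c *s y) z = c * cinner y (z::complex^'n)"
  by (simp add: cinner_def sum_distrib_left mult.assoc)

lemma cinner_norm: "norm (y::complex^'n) = 1 \<Longrightarrow> cinner y y = 1"
proof -
  assume n: "norm y = 1"
  have "cinner y y = (\<Sum>i\<in>UNIV. of_real ((norm (y$i))^2))"
    unfolding cinner_def by (rule sum.cong) (simp_all only: complex_norm_square)
  also have "\<dots> = of_real (\<Sum>i\<in>UNIV. (norm (y$i))^2)" by simp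
  also have "(\<Sum>i\<in>UNIV. (norm (y$i))^2) = (norm y)^2"
    by (simp add: norm_vec_def L2_set_def sum_nonneg)
  finally show ?thesis using n by simp
qed

text \<open>The rank-one operator v \<mapsto> (v, y) y; for a unit vector y it is the projection onto C y.\<close>
definition rk1 :: "complex^'n \<Rightarrow> complex^'n^'n" where
  "rk1 y = (\<chi> a b. y$a * cnj (y$b))"

lemma rk1_mv: "rk1 y *v v = cinner v y *s y"
  by (simp add: rk1_def matrix_vector_mult_def cinner_def vec_eq_iff sum_distrib_left mult_ac)

lemma rk1_adj: "madj (rk1 y) = rk1 y"
  by (simp add: rk1_def madj_def vec_eq_iff mult.commute)

(* A vector state omega_y is supported by the projection onto the line C y. *)
lemma vstate_supported:
  assumes "cinner y y = 1"
  shows "supported_by (rk1 y) (vstate y)"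
  unfolding supported_by_def
proof
  fix A
  have "(rk1 y ** A ** rk1 y) *v y = rk1 y *v (A *v (rk1 y *v y))"
    by (simp add: matrix_vector_mul_assoc matrix_mul_assoc)
  also have "\<dots> = cinner (A *v y) y *s y" using assms by (simp add: rk1_mv)
  finally show "vstate y A = vstate y (rk1 y ** A ** rk1 y)"
    using assms by (simp add: vstate_def cinner_scale)
qed

lemma vstate_zero: "vstate y 0 = 0"
  by (simp add: vstate_def cinner_def)

lemma vstate_rk1: "cinner y y = 1 \<Longrightarrow> vstate y (rk1 y) = 1"
  by (simp add: vstate_def rk1_mv cinner_scale)

(* Linearly independent vectors span independent lines, so their rank-one projections admit
   separating matrices. *)
lemma lines_separated:
  fixes x :: "nat \<Rightarrow> complex^'n"
  assumes lind: "\<forall>c::nat \<Rightarrow> complex. (\<Sum>i<p. c i *s x i) = 0 \<longrightarrow> (\<forall>i<p. c i = 0)"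
  shows "\<exists>Es. separates p (\<lambda>i. rk1 (x i)) Es"
proof -
  define Ls where "Ls i = {c *s x i | c. True}" for i
  have subs: "\<forall>i<p. csubspace (Ls i)"
  proof (intro allI impI)
    fix i
    have "0 = (0::complex) *s x i" by simp
    moreover have "a *s x i + b *s x i = (a + b) *s x i" for a b by (simp add: vector_sadd_rdistrib)
    moreover have "d *s (a *s x i) = (d * a) *s x i" for a d by simp
    ultimately show "csubspace (Ls i)" unfolding csubspace_def Ls_def by blast
  qed
  have ind: "\<forall>v. (\<forall>i<p. v i \<in> Ls i) \<and> (\<Sum>i<p. v i) = 0 \<longrightarrow> (\<forall>i<p. v i = 0)"
  proof (intro allI impI)
    fix v i assume v: "(\<forall>i<p. v i \<in> Ls i) \<and> (\<Sum>i<p. v i) = 0" and ip: "i < p"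
    have "\<forall>i. \<exists>a. i < p \<longrightarrow> v i = a *s x i" using v unfolding Ls_def by blast
    then obtain coef where coef: "\<forall>i<p. v i = coef i *s x i" by metis
    have "(\<Sum>i<p. coef i *s x i) = 0" using v coef by simp
    then show "v i = 0" using lind coef ip by simp
  qed
  have "\<forall>j<p. \<forall>v. rk1 (x j) *v v \<in> Ls j" by (auto simp: Ls_def rk1_mv)
  then show ?thesis by (rule separating_matrices_exist[OF subs ind])
qed

(* Vector states of linearly independent unit vectors are linearly independent over R:
   recover the i-th coefficient as the value at E_i^* E_i. *)
theorem vector_states_independent:
  fixes x :: "nat \<Rightarrow> complex^'n"
  assumes unit: "\<forall>i<p. cinner (x i) (x i) = 1" and sep: "separates p (\<lambda>i. rk1 (x i)) Es"
    and zero: "(\<lambda>A. \<Sum>i<p. of_real (r i) * vstate (x i) A) = (\<lambda>A. 0)" and ip: "i < p"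
  shows "r i = 0"
proof -
  have supp: "\<forall>j\<in>{..<p}. supported_by (rk1 (x j)) (\<lambda>A. of_real (r j) * vstate (x j) A)
                   \<and> of_real (r j) * vstate (x j) 0 = 0"
  proof
    fix j assume "j \<in> {..<p}"
    then have "supported_by (rk1 (x j)) (vstate (x j))" by (intro vstate_supported) (use unit in auto)
    then show "supported_by (rk1 (x j)) (\<lambda>A. of_real (r j) * vstate (x j) A)
                   \<and> of_real (r j) * vstate (x j) 0 = 0"
      by (simp add: supported_by_def vstate_zero)
  qed
  have "(\<Sum>j\<in>{..<p}. of_real (r j) * vstate (x j) (madj (Es i) ** mat 1 ** Es i))
      = of_real (r i) * vstate (x i) (mat 1)"
    using component_recovery[OF _ sep subset_refl supp ip, of "mat 1"] ip by (simp add: rk1_adj)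
  moreover have "(\<Sum>j<p. of_real (r j) * vstate (x j) (madj (Es i) ** mat 1 ** Es i)) = 0"
    using fun_cong[OF zero] by simp
  moreover have "vstate (x i) (mat 1) = 1" using unit ip by (simp add: vstate_def)
  ultimately show ?thesis by simp
qed

(* A single point is trivially closed under convex combinations. *)
lemma fconv_hull_singleton: "fconv_hull {\<psi>} \<subseteq> {\<psi>}"
proof
  fix \<omega> assume "\<omega> \<in> fconv_hull {\<psi>}"
  then obtain K :: nat and c g where c: "\<forall>k<K. 0 \<le> c k \<and> g k \<in> {\<psi>}" "(\<Sum>k<K. c k) = 1"
      and \<omega>: "\<omega> = (\<lambda>A. \<Sum>k<K. of_real (c k) * g k A)"
    by (rule fconv_hull_memberE)
  have "\<omega> A = \<psi> A" for A
  proof -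
    have "\<omega> A = (\<Sum>k<K. of_real (c k) * \<psi> A)" using c(1) by (simp add: \<omega>)
    also have "\<dots> = of_real (\<Sum>k<K. c k) * \<psi> A" by (simp add: sum_distrib_right)
    finally show ?thesis using c(2) by simp
  qed
  then show "\<omega> \<in> {\<psi>}" by auto
qed

(* Their convex hull is a simplex: the singletons {omega_(x_i)} satisfy the criterion. *)
theorem vector_states_simplex:
  fixes x :: "nat \<Rightarrow> complex^'n"
  assumes unit: "\<forall>i<p. cinner (x i) (x i) = 1" and sep: "separates p (\<lambda>i. rk1 (x i)) Es"
  shows "is_simplex (fconv_hull (vstate ` x ` {..<p}))"
proof -
  have "pieces_normalised p (\<lambda>i. rk1 (x i)) (\<lambda>i. {vstate (x i)})"
    unfolding pieces_normalised_def using unit vstate_supported vstate_zero vstate_rk1 by auto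
  then have dcs: "direct_convex_sum (fconv_hull (\<Union>i<p. {vstate (x i)})) p (\<lambda>i. {vstate (x i)})"
    by (intro direct_convex_sum_criterion[OF _ sep]) (simp_all add: rk1_adj fconv_hull_singleton)
  have "vstate ` x ` {..<p} = (\<Union>i<p. {vstate (x i)})" by auto
  with dcs show ?thesis unfolding is_simplex_def by auto
qed

theorem mainTheorem1:
  shows
  "(\<forall>(L :: (complex^'n) set) (Ls :: nat \<Rightarrow> (complex^'n) set) (Qs :: nat \<Rightarrow> complex^'n^'n) (p::nat).
      (\<forall>i<p. csubspace (Ls i)) \<and>
      L = {(\<Sum>i<p. v i) | v. \<forall>i<p. v i \<in> Ls i} \<and>
      (\<forall>v. (\<forall>i<p. v i \<in> Ls i) \<and> (\<Sum>i<p. v i) = 0 \<longrightarrow> (\<forall>i<p. v i = 0)) \<and>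
      (\<forall>i<p. is_orth_proj (Qs i) (Ls i))
    \<longrightarrow> direct_convex_sum (fconv_hull (\<Union>i<p. face (Qs i))) p (\<lambda>i. face (Qs i)))
   \<and>
   (\<forall>(x :: nat \<Rightarrow> complex^'n) (p::nat).
      (\<forall>i<p. norm (x i) = 1) \<and>
      (\<forall>c::nat \<Rightarrow> complex. (\<Sum>i<p. c i *s x i) = 0 \<longrightarrow> (\<forall>i<p. c i = 0))
    \<longrightarrow> (\<forall>r::nat \<Rightarrow> real. (\<lambda>A. \<Sum>i<p. of_real (r i) * vstate (x i) A) = (\<lambda>A. 0)
            \<longrightarrow> (\<forall>i<p. r i = 0)) \<and>
        is_simplex (fconv_hull (vstate ` x ` {..<p})))"
proof (intro conjI allI impI)
  fix L :: "(complex^'n) set" and Ls :: "nat \<Rightarrow> (complex^'n) set" and Qs :: "nat \<Rightarrow> complex^'n^'n"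
    and p :: nat
  assume "(\<forall>i<p. csubspace (Ls i)) \<and> L = {(\<Sum>i<p. v i) | v. \<forall>i<p. v i \<in> Ls i} \<and>
      (\<forall>v. (\<forall>i<p. v i \<in> Ls i) \<and> (\<Sum>i<p. v i) = 0 \<longrightarrow> (\<forall>i<p. v i = 0)) \<and>
      (\<forall>i<p. is_orth_proj (Qs i) (Ls i))"
  then show "direct_convex_sum (fconv_hull (\<Union>i<p. face (Qs i))) p (\<lambda>i. face (Qs i))"
    using faces_direct_convex_sum by blast
next
  fix x :: "nat \<Rightarrow> complex^'n" and p :: nat
  assume H: "(\<forall>i<p. norm (x i) = 1) \<and>
      (\<forall>c::nat \<Rightarrow> complex. (\<Sum>i<p. c i *s x i) = 0 \<longrightarrow> (\<forall>i<p. c i = 0))"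
  then have unit: "\<forall>i<p. cinner (x i) (x i) = 1" using cinner_norm by blast
  obtain Es where sep: "separates p (\<lambda>i. rk1 (x i)) Es" using lines_separated H by blast
  show "is_simplex (fconv_hull (vstate ` x ` {..<p}))"
    using vector_states_simplex[OF unit sep] .
  fix r :: "nat \<Rightarrow> real" and i
  assume "(\<lambda>A. \<Sum>i<p. of_real (r i) * vstate (x i) A) = (\<lambda>A. 0)" and "i < p"
  then show "r i = 0" using vector_states_independent[OF unit sep] by blast
qed

end
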